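(* Let $\mathbf{A}\in\mathbb{R}^{N\times N}$ be diagonalizable with eigendecomposition $\mathbf{A}=\mathbf{V}\boldsymbol{\Lambda}\mathbf{V}^{-1}$ in which $\mathbf{V}$ is unitary ($\mathbf{V}^H=\mathbf{V}^{-1}$), and let $\mathbf{A}_e=\mathbf{V}\,\mathrm{diag}(\lambda_{e_1},\dots,\lambda_{e_N})\mathbf{V}^{-1}$ with $\lambda_{e_k}=e^{-\mathrm{i}2\pi(k-1)/N}$. Let $\mathbf{x},\mathbf{y}\in\mathbb{C}^N$, let $\mathbf{y}_{\mathcal{F}}=\mathbf{V}^{-1}\mathbf{y}$, and assume $\mathbf{y}_{\mathcal F}(n)\neq0$ for all $n=1,\dots,N$. Then the solution $\mathbf{h}=[h_0,\dots,h_{N-1}]^T\in\mathbb{C}^N$ of the optimal filtering problem $$\min_{\mathbf{h}\in\mathbb{C}^N}\Big\|\sum_{k=0}^{N-1}h_k\mathbf{A}_e^k\mathbf{y}-\mathbf{x}\Big\|_2^2$$ is given by $$\mathbf{h}_{DFT}(n)=\frac{\mathbf{r}_{\mathbf{xy},DFT}(n)}{N\,|\mathbf{y}_{\mathcal{F}}(n)|^2},\qquad n=1,\dots,N,$$ where $\mathbf{h}_{DFT}=\mathbf{W}\mathbf{h}$, $\mathbf{r}_{\mathbf{xy},DFT}=\mathbf{W}\mathbf{r}^G_{\mathbf{xy}}$, $\mathbf{r}^G_{\mathbf{xy}}\in\mathbb{C}^N$ is the vector with entries $\mathbf{r}^G_{\mathbf{xy}}(n)=\mathbf{y}^H(\mathbf{A}_e^{n-1})^H\mathbf{x}$,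 and $\mathbf{W}$ is the unitary $N\times N$ DFT matrix.
   Context: A graph on $N$ nodes is given by a real weighted adjacency matrix $\mathbf{A}\in\mathbb{R}^{N\times N}$, diagonalizable over $\mathbb{C}$, $\mathbf{A}=\mathbf{V}\boldsymbol{\Lambda}\mathbf{V}^{-1}$ with $\mathbf{V}\in\mathbb{C}^{N\times N}$ invertible and $\boldsymbol{\Lambda}$ diagonal. $\mathbf{A}_e$ is the special graph shift operator, $\mathrm{i}=\sqrt{-1}$, and $(\cdot)^H$ is conjugate transpose. The vector $\mathbf{r}^G_{\mathbf{xy}}$ collects the graph cross-correlations of $\mathbf{x}$ and $\mathbf{y}$. The unitary DFT matrix is $\mathbf{W}(m,n)=\frac{1}{\sqrt N}e^{-\mathrm{i}2\pi(m-1)(n-1)/N}$, $1\le m,n\le N$. *)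

theory Defs
  imports Complex_Main "Jordan_Normal_Form.Schur_Decomposition"
begin

text \<open>
  Matrices and vectors are indexed from 0, so entry \<open>n\<close> below is the entry with index \<open>n + 1\<close>
  when indices run over \<open>1, \<dots>, N\<close>.
\<close>

definition vec_l2norm :: "complex vec \<Rightarrow> real" where
  "vec_l2norm v = sqrt (\<Sum>i<dim_vec v. (cmod (v $ i))\<^sup>2)"

definition dft_mat :: "nat \<Rightarrow> complex mat" where
  "dft_mat N = mat N N (\<lambda>(m, n).
     1 / complex_of_real (sqrt (real N)) * exp (- \<i> * 2 * of_real pi * of_nat m * of_nat n / of_nat N))"

definition special_gso :: "nat \<Rightarrow> complex mat \<Rightarrow> complex mat \<Rightarrow> complex mat" where
  "special_gso N V Vinv =
     V * mat_diag N (\<lambda>k. exp (- \<i> * 2 * of_real pi * of_nat k / of_nat N)) * Vinv"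

definition graph_filter :: "nat \<Rightarrow> complex mat \<Rightarrow> complex vec \<Rightarrow> complex vec \<Rightarrow> complex vec" where
  "graph_filter N Ae h y =
     finsum_vec TYPE(complex) N (\<lambda>k. h $ k \<cdot>\<^sub>v ((Ae ^\<^sub>m k) *\<^sub>v y)) {..<N}"

text \<open>
  The operation \<open>\<bullet>c\<close> conjugates its second argument, so \<open>u \<bullet>c y\<close> is \<open>y\<^sup>H u\<close> and the entries are
  \<open>y\<^sup>H (Ae\<^sup>n)\<^sup>H x\<close>.
\<close>

definition graph_cross_corr :: "nat \<Rightarrow> complex mat \<Rightarrow> complex vec \<Rightarrow> complex vec \<Rightarrow> complex vec" where
  "graph_cross_corr N Ae x y = vec N (\<lambda>n. (mat_adjoint (Ae ^\<^sub>m n) *\<^sub>v x) \<bullet>c y)"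

definition optimal_filter ::
    "nat \<Rightarrow> complex mat \<Rightarrow> complex vec \<Rightarrow> complex vec \<Rightarrow> complex vec \<Rightarrow> bool" where
  "optimal_filter N Ae x y h \<longleftrightarrow>
     is_arg_min (\<lambda>g. (vec_l2norm (graph_filter N Ae g y - x))\<^sup>2) (\<lambda>g. g \<in> carrier_vec N) h"

end

theory Submission
  imports Defs
begin

text \<open>
  In the eigenbasis the graph filter acts entrywise: \<open>V\<inverse>\<close> maps its output to
  \<open>\<surd>N \<cdot> (W h)(n) \<cdot> y\<^sub>F(n)\<close>. As no \<open>y\<^sub>F(n)\<close> vanishes and \<open>W\<close> is invertible, the residual can be made
  zero, and the minimiser is the unique \<open>h\<close> with \<open>\<surd>N \<cdot> (W h)(n) \<cdot> y\<^sub>F(n) = x\<^sub>F(n)\<close>. When \<open>V\<close> is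
  unitary, the cross-correlation is \<open>\<surd>N \<cdot> W\<^sup>H\<close> applied to the vector of the
  \<open>x\<^sub>F(n) \<cdot> cnj (y\<^sub>F(n))\<close>, which turns this equation into the claimed formula.
\<close>

section \<open>Adjoints and diagonal matrices\<close>

lemma mat_adjoint_carrier [simp]:
  assumes "A \<in> carrier_mat m n"
  shows "mat_adjoint A \<in> carrier_mat n m"
  using assms by (auto simp: mat_adjoint_def mat_of_rows_def)

lemma index_mat_adjoint:
  assumes "A \<in> carrier_mat m n" "i < n" "j < m"
  shows "mat_adjoint A $$ (i, j) = conjugate (A $$ (j, i))"
  using assms by (simp add: mat_adjoint_def mat_of_rows_index)

text \<open>Both sides expand to one double sum, taken in the two orders of summation. This moves
  \<open>Ae ^\<^sub>m n\<close> and later \<open>V\<close> across the inner product in the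
  cross-correlation.\<close>

lemma mat_adjoint_cscalar_prod:
  fixes A :: "'a :: conjugatable_field mat"
  assumes A: "A \<in> carrier_mat m n" and x: "x \<in> carrier_vec m" and u: "u \<in> carrier_vec n"
  shows "(mat_adjoint A *\<^sub>v x) \<bullet>c u = x \<bullet>c (A *\<^sub>v u)"
proof -
  have "(mat_adjoint A *\<^sub>v x) \<bullet>c u =
      (\<Sum>i<n. \<Sum>j<m. conjugate (A $$ (j, i)) * x $ j * conjugate (u $ i))"
    using A x u carrier_matD[OF mat_adjoint_carrier[OF A]]
    by (simp add: scalar_prod_def index_mat_adjoint[OF A] sum_distrib_right lessThan_atLeast0)
  also have "\<dots> = (\<Sum>j<m. \<Sum>i<n. conjugate (A $$ (j, i)) * x $ j * conjugate (u $ i))"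
    by (rule sum.swap)
  also have "\<dots> = x \<bullet>c (A *\<^sub>v u)"
    using A x u
    by (simp add: scalar_prod_def sum_distrib_left sum_conjugate conjugate_dist_mul
        lessThan_atLeast0 carrier_matD mult_ac)
  finally show ?thesis .
qed

lemma mat_diag_pow: "mat_diag n f ^\<^sub>m k = mat_diag n (\<lambda>i. (f i :: 'a :: comm_ring_1) ^ k)"
proof (induction k)
  case 0
  then show ?case by (simp add: mat_diag_def)
qed (simp add: mult.commute)

lemma mat_diag_mult_vec:
  fixes f :: "nat \<Rightarrow> 'a :: semiring_0"
  assumes v: "v \<in> carrier_vec n"
  shows "mat_diag n f *\<^sub>v v = vec n (\<lambda>i. f i * v $ i)"
proof (rule eq_vecI)
  fix i assume "i < dim_vec (vec n (\<lambda>i. f i * v $ i))"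
  then have i: "i < n" by simp
  have "(mat_diag n f *\<^sub>v v) $ i = (\<Sum>j = 0..<n. (if i = j then f j else 0) * v $ j)"
    using i v by (simp add: mat_diag_def scalar_prod_def)
  also have "\<dots> = (\<Sum>j = 0..<n. if j = i then f i * v $ i else 0)"
    by (intro sum.cong) auto
  finally show "(mat_diag n f *\<^sub>v v) $ i = vec n (\<lambda>i. f i * v $ i) $ i"
    using i by simp
qed (simp add: mat_diag_def)

section \<open>Roots of unity and the DFT matrix\<close>

text \<open>These numbers are the eigenvalues of the special shift, and their powers fill the rows
  of \<open>dft_mat\<close> up to scaling. This double role links graph filters to the DFT.\<close>

definition dft_root :: "nat \<Rightarrow> nat \<Rightarrow> complex" where
  "dft_root N k = exp (- \<i> * 2 * of_real pi * of_nat k / of_nat N)"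

text \<open>The conjugate bridges the negative exponent of the DFT and the positive one in
  \<open>bij_betw_roots_unity\<close>.\<close>

lemma dft_root_conv_cis: "dft_root N k = cnj (cis (2 * pi * real k / real N))"
proof -
  have "cnj (cis t) = exp (\<i> * complex_of_real (- t))" for t
    using cis_conv_exp[of "- t"] by (simp add: cis_cnj)
  then show ?thesis by (simp add: dft_root_def mult_ac)
qed

lemma index_dft_mat:
  assumes "m < N" "n < N"
  shows "dft_mat N $$ (m, n) = dft_root N m ^ n / complex_of_real (sqrt (real N))"
  using assms by (simp add: dft_mat_def dft_root_def exp_of_nat_mult[symmetric] mult_ac)

lemma dft_mat_carrier [simp]: "dft_mat N \<in> carrier_mat N N"
  by (simp add: dft_mat_def)

text \<open>A geometric sum whose ratio \<open>z\<close> is an \<open>N\<close>-th root of unity: it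
  vanishes unless \<open>z = 1\<close>, which happens only for \<open>k = m\<close>.\<close>

lemma dft_root_orthogonal:
  assumes k: "k < N" and m: "m < N"
  shows "(\<Sum>n<N. dft_root N k ^ n * cnj (dft_root N m ^ n)) = (if k = m then of_nat N else 0)"
proof -
  define z where "z = dft_root N k * cnj (dft_root N m)"
  have N: "N > 0" using k by simp
  \<comment> \<open>The range of this bijection yields \<open>z ^ N = 1\<close>; its injectivity
    yields \<open>z \<noteq> 1\<close>.\<close>
  have bij: "bij_betw (\<lambda>k. cis (2 * pi * real k / real N)) {..<N} {z. z ^ N = 1}"
    using bij_betw_roots_unity[OF N] .
  have one: "dft_root N j ^ N = 1" if "j < N" for j
    using bij_betw_apply[OF bij, of j] that
    by (simp add: dft_root_conv_cis flip: complex_cnj_power)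
  have unit: "dft_root N m * cnj (dft_root N m) = 1"
    by (simp add: dft_root_conv_cis cis_cnj cis_mult)
  have sum_z: "(\<Sum>n<N. dft_root N k ^ n * cnj (dft_root N m ^ n)) = (\<Sum>n<N. z ^ n)"
    by (simp add: z_def power_mult_distrib)
  show ?thesis
  proof (cases "k = m")
    case True
    then have "z = 1" using unit by (simp add: z_def)
    then show ?thesis using True sum_z by simp
  next
    case False
    have "z \<noteq> 1"
    proof
      assume "z = 1"
      have "dft_root N k = z * dft_root N m"
        using unit by (simp add: z_def mult_ac)
      then have "cis (2 * pi * real k / real N) = cis (2 * pi * real m / real N)"
        using \<open>z = 1\<close> by (simp add: dft_root_conv_cis)
      then show False
        using False k m bij by (auto simp: bij_betw_def dest: inj_onD)
    qed
    moreover have "z ^ N = 1"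
      by (simp add: z_def power_mult_distrib one k m flip: complex_cnj_power)
    ultimately show ?thesis
      using False sum_z by (simp add: geometric_sum)
  qed
qed

text \<open>Row orthogonality, with the two factors \<open>1 / sqrt N\<close> combining to cancel
  the \<open>N\<close> on the diagonal.\<close>

lemma dft_mat_unitary: "dft_mat N * mat_adjoint (dft_mat N) = 1\<^sub>m N"
proof (rule eq_matI)
  fix i j assume "i < dim_row (1\<^sub>m N :: complex mat)" "j < dim_col (1\<^sub>m N :: complex mat)"
  then have i: "i < N" and j: "j < N" by auto
  have s: "complex_of_real (sqrt (real N)) * complex_of_real (sqrt (real N)) = of_nat N"
    by (simp flip: of_real_mult)
  have "(dft_mat N * mat_adjoint (dft_mat N)) $$ (i, j) =
      (\<Sum>n<N. dft_mat N $$ (i, n) * mat_adjoint (dft_mat N) $$ (n, j))"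
    using i j carrier_matD[OF dft_mat_carrier[of N]]
      carrier_matD[OF mat_adjoint_carrier[OF dft_mat_carrier[of N]]]
    by (simp add: scalar_prod_def lessThan_atLeast0)
  also have "\<dots> = (\<Sum>n<N. dft_root N i ^ n * cnj (dft_root N j ^ n) / of_nat N)"
    using i j
    by (intro sum.cong) (auto simp: index_mat_adjoint[OF dft_mat_carrier] index_dft_mat s)
  also have "\<dots> = 1\<^sub>m N $$ (i, j)"
    using i j unfolding sum_divide_distrib[symmetric] dft_root_orthogonal[OF i j] by simp
  finally show "(dft_mat N * mat_adjoint (dft_mat N)) $$ (i, j) = 1\<^sub>m N $$ (i, j)" .
qed (use carrier_matD[OF dft_mat_carrier[of N]]
      carrier_matD[OF mat_adjoint_carrier[OF dft_mat_carrier[of N]]] in simp_all)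

text \<open>A one-sided inverse of a square matrix is two-sided, so every DFT equation has exactly
  one solution.\<close>

lemma dft_mat_mult_vec_eq_iff:
  assumes h: "h \<in> carrier_vec N" and v: "v \<in> carrier_vec N"
  shows "dft_mat N *\<^sub>v h = v \<longleftrightarrow> h = mat_adjoint (dft_mat N) *\<^sub>v v"
proof -
  let ?W = "dft_mat N" and ?U = "mat_adjoint (dft_mat N)"
  have U: "?U \<in> carrier_mat N N" by simp
  have UW: "?U * ?W = 1\<^sub>m N"
    using mat_mult_left_right_inverse[OF dft_mat_carrier U dft_mat_unitary] .
  have "?U *\<^sub>v (?W *\<^sub>v h) = h"
    using assoc_mult_mat_vec[OF U dft_mat_carrier h] h UW by simp
  moreover have "?W *\<^sub>v (?U *\<^sub>v v) = v"
    using assoc_mult_mat_vec[OF dft_mat_carrier U v] v dft_mat_unitary by simp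
  ultimately show ?thesis by metis
qed

section \<open>Graph filters in the eigenbasis\<close>

lemma vec_l2norm_eq_0_iff: "vec_l2norm v = 0 \<longleftrightarrow> (\<forall>i<dim_vec v. v $ i = 0)"
  by (auto simp: vec_l2norm_def sum_nonneg_eq_0_iff)

lemma graph_filter_carrier:
  assumes "Ae \<in> carrier_mat N N" "y \<in> carrier_vec N"
  shows "graph_filter N Ae h y \<in> carrier_vec N"
  unfolding graph_filter_def using assms
  by (intro finsum_vec_closed) (auto intro!: mult_mat_vec_carrier pow_carrier_mat)

context
  fixes N :: nat and V Vinv Ae :: "complex mat"
  assumes V: "V \<in> carrier_mat N N" and Vinv: "Vinv \<in> carrier_mat N N"
    and inv: "V * Vinv = 1\<^sub>m N" "Vinv * V = 1\<^sub>m N"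
    and Ae: "Ae = special_gso N V Vinv"
begin

lemma special_gso_eq: "Ae = V * mat_diag N (dft_root N) * Vinv"
  by (simp add: Ae special_gso_def dft_root_def[abs_def])

lemma special_gso_carrier: "Ae \<in> carrier_mat N N"
  unfolding special_gso_eq by (intro mult_carrier_mat[of _ N N] V Vinv mat_diag_dim)

text \<open>\<open>Ae\<close> is similar to a diagonal matrix, so its powers only raise the
  eigenvalues to powers.\<close>

lemma special_gso_pow_mult_vec:
  assumes y: "y \<in> carrier_vec N"
  shows "Ae ^\<^sub>m k *\<^sub>v y = V *\<^sub>v vec N (\<lambda>n. dft_root N n ^ k * (Vinv *\<^sub>v y) $ n)"
proof -
  let ?D = "mat_diag N (dft_root N)"
  have D: "mat_diag N f \<in> carrier_mat N N" for f :: "nat \<Rightarrow> complex" by simp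
  have "similar_mat_wit Ae ?D V Vinv"
    by (rule similar_mat_witI[OF inv special_gso_eq special_gso_carrier D V Vinv])
  then have "Ae ^\<^sub>m k = V * mat_diag N (\<lambda>n. dft_root N n ^ k) * Vinv"
    by (simp add: similar_mat_wit_pow_id mat_diag_pow)
  then have "Ae ^\<^sub>m k *\<^sub>v y = V *\<^sub>v (mat_diag N (\<lambda>n. dft_root N n ^ k) *\<^sub>v (Vinv *\<^sub>v y))"
    using assoc_mult_mat_vec[OF mult_carrier_mat[OF V D] Vinv y]
      assoc_mult_mat_vec[OF V D mult_mat_vec_carrier[OF Vinv y]] by simp
  then show ?thesis
    using Vinv y by (simp add: mat_diag_mult_vec)
qed

text \<open>At frequency \<open>n\<close> the filter multiplies by the polynomial with coefficients
  \<open>h\<close>, evaluated at \<open>dft_root N n\<close>. This value is a DFT coefficient of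
  \<open>h\<close>; the factor \<open>sqrt N\<close> undoes the normalisation of
  \<open>dft_mat\<close>.\<close>

lemma graph_filter_eq:
  assumes h: "h \<in> carrier_vec N" and y: "y \<in> carrier_vec N"
  shows "graph_filter N Ae h y =
    V *\<^sub>v vec N (\<lambda>n. complex_of_real (sqrt (real N)) * (dft_mat N *\<^sub>v h) $ n * (Vinv *\<^sub>v y) $ n)"
    (is "_ = V *\<^sub>v vec N ?c")
proof (rule eq_vecI)
  fix i assume "i < dim_vec (V *\<^sub>v vec N ?c)"
  then have i: "i < N" using V by simp
  have c: "?c n = (\<Sum>k<N. h $ k * dft_root N n ^ k * (Vinv *\<^sub>v y) $ n)" if n: "n < N" for n
  proof -
    have "(dft_mat N *\<^sub>v h) $ n = (\<Sum>k<N. dft_mat N $$ (n, k) * h $ k)"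
      using h n carrier_matD[OF dft_mat_carrier[of N]]
      by (simp add: scalar_prod_def lessThan_atLeast0)
    also have "\<dots> = (\<Sum>k<N. h $ k * dft_root N n ^ k) / complex_of_real (sqrt (real N))"
      unfolding sum_divide_distrib by (rule sum.cong) (simp_all add: index_dft_mat n)
    finally show ?thesis
      using n by (simp add: sum_distrib_right)
  qed
  have "graph_filter N Ae h y $ i = (\<Sum>k<N. (h $ k \<cdot>\<^sub>v (Ae ^\<^sub>m k *\<^sub>v y)) $ i)"
    unfolding graph_filter_def using i y special_gso_carrier
    by (intro index_finsum_vec) (auto intro!: mult_mat_vec_carrier pow_carrier_mat)
  also have "\<dots> = (\<Sum>k<N. \<Sum>n<N. V $$ (i, n) * (h $ k * dft_root N n ^ k * (Vinv *\<^sub>v y) $ n))"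
    using i y V
    by (intro sum.cong)
      (simp_all add: special_gso_pow_mult_vec scalar_prod_def lessThan_atLeast0
        sum_distrib_left mult_ac)
  also have "\<dots> = (\<Sum>n<N. V $$ (i, n) * ?c n)"
    by (subst sum.swap, rule sum.cong) (simp_all add: c sum_distrib_left)
  also have "\<dots> = (V *\<^sub>v vec N ?c) $ i"
    using i V by (simp add: scalar_prod_def lessThan_atLeast0)
  finally show "graph_filter N Ae h y $ i = (V *\<^sub>v vec N ?c) $ i" .
qed (use graph_filter_carrier[OF special_gso_carrier y] V in auto)

text \<open>Applying the invertible \<open>Vinv\<close> decouples the equation into scalar ones,
  each solved by a division that \<open>nz\<close> permits.\<close>

lemma graph_filter_eq_iff:
  assumes h: "h \<in> carrier_vec N" and x: "x \<in> carrier_vec N" and y: "y \<in> carrier_vec N"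
    and nz: "\<forall>n<N. (Vinv *\<^sub>v y) $ n \<noteq> 0"
  shows "graph_filter N Ae h y = x \<longleftrightarrow>
    dft_mat N *\<^sub>v h =
      vec N (\<lambda>n. (Vinv *\<^sub>v x) $ n / (complex_of_real (sqrt (real N)) * (Vinv *\<^sub>v y) $ n))"
    (is "_ \<longleftrightarrow> _ = vec N ?t")
proof -
  let ?c = "vec N (\<lambda>n. complex_of_real (sqrt (real N)) * (dft_mat N *\<^sub>v h) $ n * (Vinv *\<^sub>v y) $ n)"
  have "Vinv *\<^sub>v (V *\<^sub>v ?c) = ?c"
    using assoc_mult_mat_vec[OF Vinv V, of ?c] inv by simp
  moreover have "V *\<^sub>v (Vinv *\<^sub>v x) = x"
    using assoc_mult_mat_vec[OF V Vinv x] inv x by simp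
  ultimately have "graph_filter N Ae h y = x \<longleftrightarrow> ?c = Vinv *\<^sub>v x"
    using graph_filter_eq[OF h y] by metis
  also have "\<dots> \<longleftrightarrow> (\<forall>n<N. (dft_mat N *\<^sub>v h) $ n = ?t n)"
    using Vinv nz by (auto simp: vec_eq_iff field_simps)
  also have "\<dots> \<longleftrightarrow> dft_mat N *\<^sub>v h = vec N ?t"
    using carrier_matD[OF dft_mat_carrier[of N]] by (auto simp: vec_eq_iff)
  finally show ?thesis .
qed

text \<open>Some filter reproduces \<open>x\<close> exactly, so the least squares problem has
  minimum zero and its solutions are those of the exact equation.\<close>

lemma optimal_filter_iff:
  assumes x: "x \<in> carrier_vec N" and y: "y \<in> carrier_vec N"
    and nz: "\<forall>n<N. (Vinv *\<^sub>v y) $ n \<noteq> 0"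
  shows "optimal_filter N Ae x y h \<longleftrightarrow> h \<in> carrier_vec N \<and>
    dft_mat N *\<^sub>v h =
      vec N (\<lambda>n. (Vinv *\<^sub>v x) $ n / (complex_of_real (sqrt (real N)) * (Vinv *\<^sub>v y) $ n))"
    (is "_ \<longleftrightarrow> _ \<and> _ = ?t")
proof -
  let ?e = "\<lambda>g. (vec_l2norm (graph_filter N Ae g y - x))\<^sup>2"
  have e0: "?e g = 0 \<longleftrightarrow> dft_mat N *\<^sub>v g = ?t" if g: "g \<in> carrier_vec N" for g
  proof -
    have "?e g = 0 \<longleftrightarrow> graph_filter N Ae g y = x"
      using x graph_filter_carrier[OF special_gso_carrier y, of g]
      by (auto simp: vec_l2norm_eq_0_iff vec_eq_iff)
    then show ?thesis using graph_filter_eq_iff[OF g x y nz] by simp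
  qed
  \<comment> \<open>The inverse DFT of the required spectrum attains residual zero.\<close>
  let ?g = "mat_adjoint (dft_mat N) *\<^sub>v ?t"
  have g: "?g \<in> carrier_vec N"
    by (rule mult_mat_vec_carrier[OF mat_adjoint_carrier[OF dft_mat_carrier]]) simp
  have g0: "?e ?g = 0"
    using e0[OF g] dft_mat_mult_vec_eq_iff[OF g] by simp
  have "optimal_filter N Ae x y h \<longleftrightarrow> h \<in> carrier_vec N \<and> ?e h = 0"
  proof
    assume "optimal_filter N Ae x y h"
    then have "h \<in> carrier_vec N" "\<not> ?e ?g < ?e h"
      using g by (auto simp: optimal_filter_def is_arg_min_def)
    then show "h \<in> carrier_vec N \<and> ?e h = 0"
      unfolding g0 by simp
  qed (auto simp: optimal_filter_def is_arg_min_def)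
  then show ?thesis using e0 by blast
qed

text \<open>A correlation theorem: in the frequency domain the cross-correlation becomes the product
  of one spectrum with the conjugate of the other.\<close>

lemma dft_graph_cross_corr:
  assumes adj: "mat_adjoint V = Vinv"
    and x: "x \<in> carrier_vec N" and y: "y \<in> carrier_vec N"
  shows "dft_mat N *\<^sub>v graph_cross_corr N Ae x y =
    vec N (\<lambda>n. complex_of_real (sqrt (real N)) * (Vinv *\<^sub>v x) $ n * cnj ((Vinv *\<^sub>v y) $ n))"
    (is "_ = vec N ?c")
proof -
  have r: "graph_cross_corr N Ae x y \<in> carrier_vec N"
    by (simp add: graph_cross_corr_def)
  \<comment> \<open>The inverse form is easier to check, since the correlation is given entrywise in
    the lag \<open>i\<close>.\<close>
  have "graph_cross_corr N Ae x y = mat_adjoint (dft_mat N) *\<^sub>v vec N ?c"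
  proof (rule eq_vecI)
    fix i assume "i < dim_vec (mat_adjoint (dft_mat N) *\<^sub>v vec N ?c)"
    then have i: "i < N"
      using carrier_matD[OF mat_adjoint_carrier[OF dft_mat_carrier[of N]]] by simp
    let ?u = "vec N (\<lambda>n. dft_root N n ^ i * (Vinv *\<^sub>v y) $ n)"
    have "graph_cross_corr N Ae x y $ i = x \<bullet>c (V *\<^sub>v ?u)"
      using i mat_adjoint_cscalar_prod[OF pow_carrier_mat[OF special_gso_carrier] x y]
      by (simp add: graph_cross_corr_def special_gso_pow_mult_vec[OF y])
    \<comment> \<open>Unitarity enters here: moving \<open>V\<close> to the left factor turns it
      into \<open>Vinv\<close>.\<close>
    also have "\<dots> = (Vinv *\<^sub>v x) \<bullet>c ?u"
      using mat_adjoint_cscalar_prod[OF V x, of ?u] by (simp add: adj)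
    also have "\<dots> = (\<Sum>n<N. (Vinv *\<^sub>v x) $ n * cnj (dft_root N n ^ i * (Vinv *\<^sub>v y) $ n))"
      by (simp add: scalar_prod_def lessThan_atLeast0)
    \<comment> \<open>Entry \<open>(i, n)\<close> of the adjoint is
      \<open>cnj (dft_root N n ^ i) / sqrt N\<close>, and the \<open>sqrt N\<close> in
      \<open>?c\<close> cancels the denominator.\<close>
    also have "\<dots> = (\<Sum>n<N. mat_adjoint (dft_mat N) $$ (i, n) * ?c n)"
      using i
      by (intro sum.cong)
        (auto simp: index_mat_adjoint[OF dft_mat_carrier] index_dft_mat)
    also have "\<dots> = (mat_adjoint (dft_mat N) *\<^sub>v vec N ?c) $ i"
      using i carrier_matD[OF mat_adjoint_carrier[OF dft_mat_carrier[of N]]]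
      by (simp add: scalar_prod_def lessThan_atLeast0)
    finally show "graph_cross_corr N Ae x y $ i = (mat_adjoint (dft_mat N) *\<^sub>v vec N ?c) $ i" .
  qed (use r carrier_matD[OF mat_adjoint_carrier[OF dft_mat_carrier[of N]]] in simp)
  then show ?thesis
    using dft_mat_mult_vec_eq_iff[OF r] by simp
qed

end

theorem mainTheorem7:
  fixes N :: nat
    and A :: "real mat"
    and V Vinv \<Lambda> :: "complex mat"
    and x y :: "complex vec"
  assumes "N \<ge> 1"
    and "A \<in> carrier_mat N N"
    and "V \<in> carrier_mat N N" and "Vinv \<in> carrier_mat N N"
    and "inverts_mat V Vinv" and "inverts_mat Vinv V"
    and "\<Lambda> \<in> carrier_mat N N" and "diagonal_mat \<Lambda>"
    and "map_mat complex_of_real A = V * \<Lambda> * Vinv"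
    and "mat_adjoint V = Vinv"
    and "x \<in> carrier_vec N" and "y \<in> carrier_vec N"
    and "\<forall>n<N. (Vinv *\<^sub>v y) $ n \<noteq> 0"
  defines "Ae \<equiv> special_gso N V Vinv"
  shows "(\<exists>!h. optimal_filter N Ae x y h) \<and>
    (\<forall>h \<in> carrier_vec N. optimal_filter N Ae x y h \<longleftrightarrow>
      (\<forall>n<N. (dft_mat N *\<^sub>v h) $ n =
         (dft_mat N *\<^sub>v graph_cross_corr N Ae x y) $ n /
         complex_of_real (real N * (cmod ((Vinv *\<^sub>v y) $ n))\<^sup>2)))"
proof -
  have inv: "V * Vinv = 1\<^sub>m N" "Vinv * V = 1\<^sub>m N"
    using assms(3-6) by (auto simp: inverts_mat_def)
  note ctx = assms(3,4) inv Ae_def[THEN meta_eq_to_obj_eq]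
  let ?xF = "Vinv *\<^sub>v x" and ?yF = "Vinv *\<^sub>v y" and ?s = "complex_of_real (sqrt (real N))"
  let ?t = "vec N (\<lambda>n. ?xF $ n / (?s * ?yF $ n))"
  have opt: "optimal_filter N Ae x y h \<longleftrightarrow> h \<in> carrier_vec N \<and> dft_mat N *\<^sub>v h = ?t" for h
    using optimal_filter_iff[OF ctx assms(11-13)] .
  \<comment> \<open>Writing \<open>N\<close> as \<open>?s * ?s\<close> and the squared modulus as
    \<open>?yF $ n\<close> times its conjugate, one \<open>?s\<close> and the conjugate cancel
    against the numerator.\<close>
  have r: "(dft_mat N *\<^sub>v graph_cross_corr N Ae x y) $ n /
      complex_of_real (real N * (cmod (?yF $ n))\<^sup>2) = ?t $ n" if n: "n < N" for n
  proof -
    have "?s * ?s = of_nat N"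
      by (simp flip: of_real_mult)
    then have "complex_of_real (real N * (cmod (?yF $ n))\<^sup>2) = (?s * ?s) * (?yF $ n * cnj (?yF $ n))"
      by (simp flip: complex_norm_square)
    moreover have "?s \<noteq> 0" "?yF $ n \<noteq> 0"
      using assms(1,13) n by auto
    ultimately show ?thesis
      using n by (simp add: dft_graph_cross_corr[OF ctx assms(10-12)] divide_simps)
  qed
  show ?thesis
  proof (intro conjI ballI)
    \<comment> \<open>The inverse DFT of \<open>?t\<close> is the unique optimal filter.\<close>
    have "mat_adjoint (dft_mat N) *\<^sub>v ?t \<in> carrier_vec N"
      by (rule mult_mat_vec_carrier[OF mat_adjoint_carrier[OF dft_mat_carrier]]) simp
    then show "\<exists>!h. optimal_filter N Ae x y h"
      unfolding opt using dft_mat_mult_vec_eq_iff[of _ N ?t] by auto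
  next
    fix h :: "complex vec" assume h: "h \<in> carrier_vec N"
    have "dft_mat N *\<^sub>v h = ?t \<longleftrightarrow> (\<forall>n<N. (dft_mat N *\<^sub>v h) $ n = ?t $ n)"
      using carrier_matD[OF dft_mat_carrier[of N]] by (auto simp: vec_eq_iff)
    then show "optimal_filter N Ae x y h \<longleftrightarrow>
      (\<forall>n<N. (dft_mat N *\<^sub>v h) $ n =
         (dft_mat N *\<^sub>v graph_cross_corr N Ae x y) $ n / complex_of_real (real N * (cmod (?yF $ n))\<^sup>2))"
      using h r opt by simp
  qed
qed

end
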